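(* Suppose $f, g \in \mathcal{M}$ satisfy $\frac{f(z)+g(z)}{z} \neq 0$ for all $z \in \mathbb{D}$. Then the function $F$ given by $$F(z) = \frac{2 f(z) g(z)}{f(z)+g(z)}, \quad z \in \mathbb{D},$$ also belongs to the class $\mathcal{M}$.
   Context: $\mathbb{D} = \{z \in \mathbb{C} : |z| < 1\}$ is the open unit disk. $\mathcal{A}$ is the class of analytic functions $f$ on $\mathbb{D}$ normalized by $f(0) = f'(0) - 1 = 0$, i.e. $f(z) = z + a_2 z^2 + a_3 z^3 + \cdots$. The class $\mathcal{M}$ consists of all $f \in \mathcal{A}$ satisfying $$\left| z^2 \left( \frac{z}{f(z)} \right)'' + f'(z) \left( \frac{z}{f(z)} \right)^2 - 1 \right| \le 1, \quad z \in \mathbb{D}.$$ Here it is understood that $f(z) \ne 0$ for $0 < |z| < 1$, and that $z/f(z)$ is the analytic function on $\mathbb{D}$ with value $1$ at $z = 0$. Expressions such as $(f(z)+g(z))/z$ and $F(z)$ are taken at $z=0$ by their analytic extension (so $(f(z)+g(z))/z$ has value $2$ and $F$ has value $0$ at $z=0$). *)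

theory Defs
  imports "HOL-Complex_Analysis.Complex_Analysis"
begin

text \<open>
  Functions on the open unit disk are total functions of type \<^typ>\<open>complex \<Rightarrow> complex\<close>; membership in
  the classes below depends only on their values on \<^term>\<open>ball 0 1 :: complex set\<close>, which is open.
\<close>

definition class_A :: "(complex \<Rightarrow> complex) set" where
  "class_A = {f. f holomorphic_on ball 0 1 \<and> f 0 = 0 \<and> deriv f 0 = 1}"

text \<open>
  The function z/f(z), with its removable singularity at the origin filled in: since f(0) = 0 and
  f'(0) = 1, the limit there is 1 (HOL division would give 0).
\<close>

definition id_over :: "(complex \<Rightarrow> complex) \<Rightarrow> complex \<Rightarrow> complex" where
  "id_over f z = (if z = 0 then 1 else z / f z)"

definition class_M :: "(complex \<Rightarrow> complex) set" where
  "class_M = {f \<in> class_A.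
     (\<forall>z \<in> ball 0 1 - {0}. f z \<noteq> 0) \<and>
     (\<forall>z \<in> ball 0 1.
        norm (z^2 * (deriv ^^ 2) (id_over f) z + deriv f z * (id_over f z)^2 - 1) \<le> 1)}"

text \<open>The values at the origin used here and in the theorem are those of the analytic extensions.\<close>

lemma class_A_tendsto:
  assumes "f \<in> class_A"
  shows "((\<lambda>z. f z / z) \<longlongrightarrow> 1) (at 0)"
proof -
  have "f field_differentiable at 0"
    using assms holomorphic_on_imp_differentiable_at[of f "ball 0 1" 0]
    by (auto simp: class_A_def)
  hence "(f has_field_derivative 1) (at 0)"
    using assms DERIV_deriv_iff_field_differentiable[of f 0] by (simp add: class_A_def)
  thus ?thesis
    using assms by (simp add: has_field_derivative_iff class_A_def)
qed

lemma id_over_tendsto: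
  assumes "f \<in> class_A"
  shows "((\<lambda>z. z / f z) \<longlongrightarrow> 1) (at 0)"
  using tendsto_inverse[OF class_A_tendsto[OF assms]] by simp

lemma id_over_holomorphic:
  assumes "f \<in> class_A" "\<forall>z \<in> ball 0 1 - {0}. f z \<noteq> 0"
  shows "id_over f holomorphic_on ball 0 1"
proof (rule no_isolated_singularity'[where K = "{0}"])
  have "(\<lambda>z. z / f z) holomorphic_on ball 0 1 - {0}"
    using assms by (intro holomorphic_intros) (auto simp: class_A_def)
  thus "id_over f holomorphic_on ball 0 1 - {0}"
    by (rule holomorphic_transform) (simp add: id_over_def)
  show "(id_over f \<longlongrightarrow> id_over f z) (at z within ball 0 1)" if "z \<in> {0}" for z
  proof -
    have "\<forall>\<^sub>F z in at 0. z / f z = id_over f z"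
      by (simp add: id_over_def eventually_at_filter)
    hence "(id_over f \<longlongrightarrow> 1) (at 0)"
      using id_over_tendsto[OF assms(1)] by (rule Lim_transform_eventually[rotated])
    hence "(id_over f \<longlongrightarrow> 1) (at 0 within ball 0 1)"
      by (rule tendsto_within_subset) simp
    thus ?thesis
      using that by (simp add: id_over_def)
  qed
qed auto

lemma sum_over_id_tendsto:
  assumes "f \<in> class_A" "g \<in> class_A"
  shows "((\<lambda>z. (f z + g z) / z) \<longlongrightarrow> 2) (at 0)"
  using tendsto_add[OF class_A_tendsto[OF assms(1)] class_A_tendsto[OF assms(2)]]
  by (simp add: add_divide_distrib)

lemma harmonic_mean_tendsto:
  assumes "f \<in> class_A" "g \<in> class_A"
  shows "((\<lambda>z. 2 * f z * g z / (f z + g z)) \<longlongrightarrow> 0) (at 0)"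
proof -
  have "((\<lambda>z. z * (2 * (f z / z) * (g z / z) / ((f z + g z) / z))) \<longlongrightarrow> 0 * (2 * 1 * 1 / 2)) (at 0)"
    by (intro tendsto_intros class_A_tendsto sum_over_id_tendsto assms) simp
  moreover have "\<forall>\<^sub>F z in at 0. z * (2 * (f z / z) * (g z / z) / ((f z + g z) / z))
      = 2 * f z * g z / (f z + g z)"
    by (simp add: eventually_at_filter)
  ultimately show ?thesis
    using Lim_transform_eventually by fastforce
qed

end

theory Submission
  imports Defs
begin

text \<open>
  In terms of \<open>p(z) = z / f(z)\<close> one has \<open>f'(z) (z/f(z))\<^sup>2 = p(z) - z p'(z)\<close>, so the function whose
  modulus is bounded in the definition of the class is \<open>z\<^sup>2 p'' - z p' + p - 1\<close>, an affine expression
  in \<open>p\<close>. The harmonic mean \<open>F\<close> of \<open>f\<close> and \<open>g\<close> corresponds to the arithmetic mean of \<open>z/f\<close> and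
  \<open>z/g\<close>, so its expression is the midpoint of those of \<open>f\<close> and \<open>g\<close>, and the closed unit disk
  is convex. The hypothesis \<open>(f + g)/z \<noteq> 0\<close> says precisely that this arithmetic mean has no
  zeros, so that \<open>F\<close> is analytic. Lemma \<open>class_M_iff_reciprocal\<close> carries out the translation into
  \<open>p\<close>, and \<open>M_operator_mean\<close> is the linearity.
\<close>

text \<open>
  Written as the linear part of the affine expression; the class condition is that its value stays
  within distance 1 of 1.
\<close>

definition M_operator :: "(complex \<Rightarrow> complex) \<Rightarrow> complex \<Rightarrow> complex" where
  "M_operator p z = z^2 * (deriv ^^ 2) p z - z * deriv p z + p z"

lemma M_operator_mean:
  assumes "p holomorphic_on S" "q holomorphic_on S" "open S" "z \<in> S"
  shows "M_operator (\<lambda>w. (p w + q w) / 2) z = (M_operator p z + M_operator q z) / 2"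
proof -
  have deriv_mean: "(deriv ^^ n) (\<lambda>w. (p w + q w) / 2) z = ((deriv ^^ n) p z + (deriv ^^ n) q z) / 2"
    for n
  proof -
    have "(deriv ^^ n) (\<lambda>w. (1/2) * (p w + q w)) z = (1/2) * (deriv ^^ n) (\<lambda>w. p w + q w) z"
      using assms by (intro higher_deriv_cmult[where A = S] holomorphic_intros) auto
    also have "(deriv ^^ n) (\<lambda>w. p w + q w) z = (deriv ^^ n) p z + (deriv ^^ n) q z"
      using assms by (intro higher_deriv_add) auto
    finally show ?thesis by simp
  qed
  show ?thesis
    using deriv_mean[of 1] deriv_mean[of 2]
    by (simp add: M_operator_def add_divide_distrib diff_divide_distrib distrib_left)
qed

text \<open>
  With \<open>f = z/p\<close> the quotient rule gives \<open>f' = (p - z p') / p\<^sup>2\<close>. This yields the normalization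
  \<open>f'(0) = 1\<close> from \<open>p(0) = 1\<close>, and after multiplication by \<open>(z/f)\<^sup>2 = p\<^sup>2\<close> it removes the
  nonlinearity in \<open>p\<close>.
\<close>

lemma class_M_iff_reciprocal:
  assumes p: "p holomorphic_on ball 0 1" "p 0 = 1"
    and nz: "\<And>z. z \<in> ball 0 1 \<Longrightarrow> p z \<noteq> 0"
    and f: "\<And>z. z \<in> ball 0 1 \<Longrightarrow> f z = z / p z"
  shows "f \<in> class_M \<longleftrightarrow> (\<forall>z \<in> ball 0 1. norm (M_operator p z - 1) \<le> 1)"
proof -
  have f_deriv: "deriv f z = (p z - z * deriv p z) / (p z)^2" if z: "z \<in> ball 0 1" for z
  proof -
    have "(p has_field_derivative deriv p z) (at z)"
      using holomorphic_derivI[OF p(1) open_ball z] .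
    hence "((\<lambda>w. w / p w) has_field_derivative (p z - z * deriv p z) / (p z)^2) (at z)"
      using nz[OF z] by (auto intro!: derivative_eq_intros simp: power2_eq_square)
    hence "(f has_field_derivative (p z - z * deriv p z) / (p z)^2) (at z)"
      by (rule has_field_derivative_transform_within_open[OF _ open_ball z]) (simp add: f)
    thus ?thesis by (rule DERIV_imp_deriv)
  qed
  have "(\<lambda>z. z / p z) holomorphic_on ball 0 1"
    using p(1) nz by (intro holomorphic_intros) auto
  hence "f holomorphic_on ball 0 1"
    by (rule holomorphic_transform) (simp add: f)
  hence "f \<in> class_A"
    using f_deriv[of 0] f[of 0] p(2) by (simp add: class_A_def)
  moreover have "\<forall>z \<in> ball 0 1 - {0}. f z \<noteq> 0"
    using f nz by auto
  moreover have "z^2 * (deriv ^^ 2) (id_over f) z + deriv f z * (id_over f z)^2 - 1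
      = M_operator p z - 1" if z: "z \<in> ball 0 1" for z
  proof -
    have id_over_eq: "id_over f w = p w" if "w \<in> ball 0 1" for w
      using f[OF that] nz[OF that] p(2) by (simp add: id_over_def)
    hence "id_over f holomorphic_on ball 0 1"
      using holomorphic_transform[OF p(1)] by metis
    hence "(deriv ^^ 2) (id_over f) z = (deriv ^^ 2) p z"
      using p(1) id_over_eq z by (intro higher_deriv_transform_within_open[where S = "ball 0 1"]) auto
    thus ?thesis
      using f_deriv[OF z] nz[OF z] id_over_eq[OF z] by (simp add: M_operator_def)
  qed
  ultimately show ?thesis
    by (simp add: class_M_def)
qed

text \<open>
  Every member of the class arises from its own reciprocal \<open>p = id_over f\<close>, so the bound transfers
  to \<open>p\<close>.
\<close>

lemma class_M_id_over:
  assumes "f \<in> class_M"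
  shows "id_over f holomorphic_on ball 0 1"
    and "z \<in> ball 0 1 \<Longrightarrow> id_over f z \<noteq> 0"
    and "z \<in> ball 0 1 \<Longrightarrow> norm (M_operator (id_over f) z - 1) \<le> 1"
proof -
  have A: "f \<in> class_A" and nz: "\<forall>z \<in> ball 0 1 - {0}. f z \<noteq> 0"
    using assms by (auto simp: class_M_def)
  show hol: "id_over f holomorphic_on ball 0 1"
    using A nz by (rule id_over_holomorphic)
  have id_over_nz: "id_over f z \<noteq> 0" if "z \<in> ball 0 1" for z
    using nz that by (auto simp: id_over_def)
  thus "z \<in> ball 0 1 \<Longrightarrow> id_over f z \<noteq> 0" .
  have "f z = z / id_over f z" if "z \<in> ball 0 1" for z
    using A by (simp add: id_over_def class_A_def)
  thus "z \<in> ball 0 1 \<Longrightarrow> norm (M_operator (id_over f) z - 1) \<le> 1"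
    using class_M_iff_reciprocal[of "id_over f" f] hol id_over_nz assms
    by (simp add: id_over_def)
qed

theorem theorem2:
  fixes f g :: "complex \<Rightarrow> complex"
  assumes "f \<in> class_M" and "g \<in> class_M"
    and "\<forall>z \<in> ball 0 1. (if z = 0 then 2 else (f z + g z) / z) \<noteq> 0"
  shows "(\<lambda>z. if z = 0 then 0 else 2 * f z * g z / (f z + g z)) \<in> class_M"
proof -
  define h where "h = (\<lambda>z. (id_over f z + id_over g z) / 2)"
  note F = class_M_id_over[OF assms(1)] and G = class_M_id_over[OF assms(2)]
  have fg: "f z \<noteq> 0" "g z \<noteq> 0" "f z + g z \<noteq> 0" if "z \<in> ball 0 1" "z \<noteq> 0" for z
    using assms(1,2) bspec[OF assms(3) that(1)] that by (auto simp: class_M_def)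
  have h_eq: "h z = z * (f z + g z) / (2 * f z * g z)" if "z \<in> ball 0 1" "z \<noteq> 0" for z
    using fg[OF that] that by (simp add: h_def id_over_def field_simps)
  have "h holomorphic_on ball 0 1"
    unfolding h_def using F(1) G(1) by (intro holomorphic_intros) auto
  moreover have "h 0 = 1"
    by (simp add: h_def id_over_def)
  moreover have "h z \<noteq> 0" if "z \<in> ball 0 1" for z
    using h_eq[OF that] fg[OF that] \<open>h 0 = 1\<close> by (cases "z = 0") auto
  moreover have "(if z = 0 then 0 else 2 * f z * g z / (f z + g z)) = z / h z"
    if "z \<in> ball 0 1" for z
    using h_eq[OF that] fg[OF that] by simp
  moreover have "norm (M_operator h z - 1) \<le> 1" if z: "z \<in> ball 0 1" for z
  proof -
    have "M_operator h z - 1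
        = ((M_operator (id_over f) z - 1) + (M_operator (id_over g) z - 1)) / 2"
      unfolding h_def M_operator_mean[OF F(1) G(1) open_ball z] by (simp add: field_simps)
    also have "norm \<dots> \<le> (1 + 1) / 2"
      unfolding norm_divide using norm_triangle_mono[OF F(3)[OF z] G(3)[OF z]] by simp
    finally show ?thesis by simp
  qed
  ultimately show ?thesis
    by (subst class_M_iff_reciprocal[where p = h]) blast+
qed

end
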